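(* Let $d\ge2$ and let $\mathcal{P}'=\{P_{j,k}:0\le j,k\le d-1\}$ be the system of rank one projections on $\mathbb{C}^d$ associated with the generalized Gell-Mann basis $\{T_{jk}\}$ as defined in the context. Then $\mathcal{P}'$ is an informationally complete system of rank one projections, with quantum mechanical overlaps $\mathrm{tr}(PP')$, $P,P'\in\mathcal{P}'$, taking values in $\{0,1,\tfrac12,\tfrac14\}$.
   Context: Let $\{|j\rangle:0\le j\le d-1\}$ be the standard basis of $\mathbb{C}^d$ and $J_{j,k}=|j\rangle\langle k|$. The generalized Gell-Mann basis is: $T_{00}=I_d$, $T_{jj}=\sum_{m=0}^{j-1}J_{m,m}-jJ_{j,j}$ for $1\le j\le d-1$; $T_{jk}=J_{j,k}+J_{k,j}$ and $T_{kj}=-i(J_{j,k}-J_{k,j})$ for $0\le j<k\le d-1$. Set $P_{j,j}=P_j=|j\rangle\langle j|$, and for $0\le j<k\le d-1$, $$P_{j,k}=\tfrac12(P_j+P_k+T_{jk}),\qquad P_{k,j}=\tfrac12(P_j+P_k+T_{kj}).$$ These are the rank one projections onto the lines spanned by $\frac1{\sqrt2}(|j\rangle+|k\rangle)$ and $\frac1{\sqrt2}(|j\rangle+i|k\rangle)$ respectively. A set of rank one projections on $\mathbb{C}^d$ is informationally complete if every operator $\rho$ on $\mathbb{C}^d$ is determined by the numbers $\mathrm{tr}(\rho P)$, $P$ in the set; equivalently, the set spans the algebra of complex $d\times d$ matrices. *)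

theory Defs
  imports
    Complex_Main
    "Jordan_Normal_Form.Matrix"
    "Jordan_Normal_Form.Schur_Decomposition"
    "Jordan_Normal_Form.DL_Rank"
begin

text \<open>Operators on \<open>\<complex>\<^sup>d\<close> are the complex matrices in \<open>carrier_mat d d\<close>; rows and columns
  are numbered from 0, and \<open>unit_vec d j\<close> with \<open>j < d\<close> is the standard basis vector \<open>|j\<rangle>\<close>.\<close>

definition mat_trace :: "'a::comm_monoid_add mat \<Rightarrow> 'a" where
  "mat_trace A = (\<Sum>i<dim_row A. A $$ (i, i))"

text \<open>The operator \<open>|v\<rangle>\<langle>w|\<close>, conjugate linear in \<open>w\<close>.\<close>

definition ket_bra :: "complex vec \<Rightarrow> complex vec \<Rightarrow> complex mat" where
  "ket_bra v w = mat (dim_vec v) (dim_vec w) (\<lambda>(a, b). v $ a * cnj (w $ b))"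

definition J_mat :: "nat \<Rightarrow> nat \<Rightarrow> nat \<Rightarrow> complex mat" where
  "J_mat d j k = ket_bra (unit_vec d j) (unit_vec d k)"

text \<open>In the last case of \<open>gell_mann\<close> and of \<open>gell_mann_proj\<close> the first index is the larger
  one, so the roles of \<open>j\<close> and \<open>k\<close> are exchanged with respect to the usual formulas for
  \<open>T\<^sub>k\<^sub>j\<close> and \<open>P\<^sub>k\<^sub>j\<close> with \<open>j < k\<close>.\<close>

definition gell_mann :: "nat \<Rightarrow> nat \<Rightarrow> nat \<Rightarrow> complex mat" where
  "gell_mann d j k =
    (if j = k then
       (if j = 0 then 1\<^sub>m d
        else finsum (module_mat TYPE(complex) d d) (\<lambda>m. J_mat d m m) {..<j}
               - of_nat j \<cdot>\<^sub>m J_mat d j j)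
     else if j < k then J_mat d j k + J_mat d k j
     else (- \<i>) \<cdot>\<^sub>m (J_mat d k j - J_mat d j k))"

definition basis_proj :: "nat \<Rightarrow> nat \<Rightarrow> complex mat" where
  "basis_proj d j = ket_bra (unit_vec d j) (unit_vec d j)"

definition gell_mann_proj :: "nat \<Rightarrow> nat \<Rightarrow> nat \<Rightarrow> complex mat" where
  "gell_mann_proj d j k =
    (if j = k then basis_proj d j
     else if j < k then (1/2) \<cdot>\<^sub>m (basis_proj d j + basis_proj d k + gell_mann d j k)
     else (1/2) \<cdot>\<^sub>m (basis_proj d k + basis_proj d j + gell_mann d j k))"

definition gell_mann_system :: "nat \<Rightarrow> complex mat set" where
  "gell_mann_system d = {gell_mann_proj d j k | j k. j < d \<and> k < d}"

text \<open>Projections are orthogonal projections.\<close>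

definition rank_one_projection :: "nat \<Rightarrow> complex mat \<Rightarrow> bool" where
  "rank_one_projection d A \<longleftrightarrow>
     A \<in> carrier_mat d d \<and> A * A = A \<and> mat_adjoint A = A \<and>
     vec_space.rank d A = 1"

text \<open>The operators \<open>\<rho>\<close>, \<open>\<sigma>\<close> are arbitrary matrices, not only density matrices.\<close>

definition informationally_complete :: "nat \<Rightarrow> complex mat set \<Rightarrow> bool" where
  "informationally_complete d S \<longleftrightarrow>
     (\<forall>\<rho> \<in> carrier_mat d d. \<forall>\<sigma> \<in> carrier_mat d d.
        (\<forall>P \<in> S. mat_trace (\<rho> * P) = mat_trace (\<sigma> * P)) \<longrightarrow> \<rho> = \<sigma>)"

end

theory Submission
  imports Defs
begin

text \<open>Up to the factor 1 or 1/2, each \<open>P\<^sub>j\<^sub>k\<close> is \<open>|v\<rangle>\<langle>v|\<close> with \<open>v\<close> one of \<open>e\<^sub>j\<close>, \<open>e\<^sub>j + e\<^sub>k\<close>,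
  \<open>e\<^sub>k + \<i>e\<^sub>j\<close>. The overlap of two such projections is therefore the squared modulus of an inner
  product, up to these factors, and this inner product has at most two nonzero terms. The value
  \<open>tr (\<rho> P)\<close> is a quadratic form in \<open>\<rho>\<close>: the diagonal projections give the diagonal of \<open>\<rho>\<close>, and then
  the two projections belonging to \<open>j < k\<close> give the sum and the difference of the entries
  \<open>\<rho>\<^sub>j\<^sub>k\<close> and \<open>\<rho>\<^sub>k\<^sub>j\<close>.\<close>

text \<open>The column through the nonzero entry is a nonzero vector, hence linearly independent on
  its own.\<close>

lemma (in vec_space) rank_ge_1I:
  assumes "A \<in> carrier_mat n nc" and "i < n" and "j < nc" and "A $$ (i, j) \<noteq> 0"
  shows "rank A \<ge> 1"
proof -
  have col: "col A j \<in> carrier_vec n"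
    using assms by auto
  have "col A j $ i \<noteq> 0"
    using assms by simp
  then have "col A j \<noteq> 0\<^sub>v n"
    using \<open>i < n\<close> by auto
  then have "lin_indpt {col A j}"
    using lindep_span[of "{col A j}"] col span_empty by auto
  moreover have "{col A j} \<subseteq> set (cols A)"
    using assms by (auto simp: cols_def)
  ultimately show ?thesis
    using rank_ge_card_indpt[OF assms(1), of "{col A j}"] by simp
qed

lemma ket_bra_carrier [simp]:
  "v \<in> carrier_vec n \<Longrightarrow> w \<in> carrier_vec m \<Longrightarrow> ket_bra v w \<in> carrier_mat n m"
  by (auto simp: ket_bra_def)

lemma ket_bra_index [simp]:
  "i < dim_vec v \<Longrightarrow> j < dim_vec w \<Longrightarrow> ket_bra v w $$ (i, j) = v $ i * cnj (w $ j)"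
  "dim_row (ket_bra v w) = dim_vec v" "dim_col (ket_bra v w) = dim_vec w"
  by (auto simp: ket_bra_def)

text \<open>The middle factors contract to a scalar. Since \<open>\<bullet>c\<close> conjugates its
  right argument, \<open>w \<bullet>c v\<close> is the bracket of \<open>v\<close> with
  \<open>w\<close>, antilinear in \<open>v\<close>.\<close>

lemma ket_bra_mult:
  assumes "dim_vec v = dim_vec w"
  shows "ket_bra u v * ket_bra w x = (w \<bullet>c v) \<cdot>\<^sub>m ket_bra u x"
proof (rule eq_matI, goal_cases)
  case (1 i j)
  then have "(ket_bra u v * ket_bra w x) $$ (i, j)
      = (\<Sum>l = 0..<dim_vec v. (u $ i * cnj (x $ j)) * (w $ l * cnj (v $ l)))"
    using assms by (auto simp: scalar_prod_def intro!: sum.cong)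
  also have "\<dots> = ((w \<bullet>c v) \<cdot>\<^sub>m ket_bra u x) $$ (i, j)"
    using 1 assms by (simp add: scalar_prod_def sum_distrib_left mult.commute)
  finally show ?case .
qed (use assms in auto)

lemma mat_trace_ket_bra:
  assumes "dim_vec v = dim_vec w"
  shows "mat_trace (ket_bra v w) = v \<bullet>c w"
  using assms by (simp add: mat_trace_def scalar_prod_def atLeast0LessThan)

lemma mat_trace_smult:
  fixes A :: "complex mat"
  assumes "A \<in> carrier_mat n n"
  shows "mat_trace (c \<cdot>\<^sub>m A) = c * mat_trace A"
  using assms by (auto simp: mat_trace_def sum_distrib_left)

lemma mult_ket_bra:
  assumes "A \<in> carrier_mat n (dim_vec v)"
  shows "A * ket_bra v w = ket_bra (A *\<^sub>v v) w"
proof (rule eq_matI, goal_cases)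
  case (1 i j)
  then show ?case
    using assms by (auto simp: scalar_prod_def sum_distrib_right mult.assoc intro!: sum.cong)
qed (use assms in auto)

lemma mat_adjoint_index:
  "i < dim_col A \<Longrightarrow> j < dim_row A \<Longrightarrow> mat_adjoint A $$ (i, j) = conjugate (A $$ (j, i))"
  by (simp add: mat_adjoint_def mat_of_rows_index)

lemma mat_adjoint_dim [simp]:
  "dim_row (mat_adjoint A) = dim_col A" "dim_col (mat_adjoint A) = dim_row A"
  by (auto simp: mat_adjoint_def)

text \<open>Squaring produces the extra factor \<open>c * (v \<bullet>c v)\<close>, which is 1, and
  \<open>c\<close> being real gives self-adjointness. The rank is at most 1 because each entry is a
  function of the row times a function of the column.\<close>

lemma rank_one_projection_ket_bra:
  fixes c :: real
  assumes v: "v \<in> carrier_vec d" and norm: "of_real c * (v \<bullet>c v) = 1"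
  shows "rank_one_projection d (of_real c \<cdot>\<^sub>m ket_bra v v)" (is "rank_one_projection d ?P")
proof -
  have dim: "dim_vec v = d" and P: "?P \<in> carrier_mat d d"
    using v by auto
  have kb: "ket_bra v v \<in> carrier_mat d d"
    using v by simp
  have "?P * ?P = (of_real c * (of_real c * (v \<bullet>c v))) \<cdot>\<^sub>m ket_bra v v"
    by (simp add: mult_smult_distrib[of _ d d _ d] mult_smult_assoc_mat[of _ d d _ d] kb ket_bra_mult)
      (auto intro!: eq_matI)
  then have idem: "?P * ?P = ?P"
    using norm by simp
  have adj: "mat_adjoint ?P = ?P"
    by (rule eq_matI) (auto simp: mat_adjoint_index dim)
  have "v \<noteq> 0\<^sub>v d"
    using norm by auto
  then obtain i where i: "i < d" "v $ i \<noteq> 0"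
    using dim by (metis eq_vecI index_zero_vec)
  have "c \<noteq> 0"
    using norm by auto
  \<comment> \<open>The diagonal entry at \<open>i\<close> is \<open>c\<close> times the squared
    modulus of \<open>v $ i\<close>, so it is nonzero.\<close>
  then have "vec_space.rank d ?P \<ge> 1"
    using i dim by (intro vec_space.rank_ge_1I[OF P, of i i]) auto
  moreover have "vec_space.rank d ?P \<le> 1"
    using dim by (intro vec_space.rank_le_1_product_entries[OF P, of "\<lambda>r. c * v $ r" "\<lambda>s. cnj (v $ s)"]) auto
  ultimately show ?thesis
    using P idem adj by (simp add: rank_one_projection_def)
qed

text \<open>Left unnormalised, which keeps square roots out of the computations. The factor \<i>
  always sits at the larger index.\<close>

definition gell_mann_vec :: "nat \<Rightarrow> nat \<Rightarrow> nat \<Rightarrow> complex vec" where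
  "gell_mann_vec d j k =
    (if j = k then unit_vec d j
     else if j < k then unit_vec d j + unit_vec d k
     else unit_vec d k + \<i> \<cdot>\<^sub>v unit_vec d j)"

text \<open>For indices below \<open>d\<close>, the reciprocal of the squared norm of
  \<open>gell_mann_vec d j k\<close>.\<close>

definition gell_mann_weight :: "nat \<Rightarrow> nat \<Rightarrow> real" where
  "gell_mann_weight j k = (if j = k then 1 else 1/2)"

lemma gell_mann_vec_carrier [simp]: "gell_mann_vec d j k \<in> carrier_vec d"
  by (simp add: gell_mann_vec_def)

lemma dim_gell_mann_vec [simp]: "dim_vec (gell_mann_vec d j k) = d"
  by (simp add: gell_mann_vec_def)

lemma gell_mann_vec_index:
  "i < d \<Longrightarrow> j < d \<Longrightarrow> k < d \<Longrightarrow> gell_mann_vec d j k $ i =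
    (if j = k then of_bool (i = j)
     else if j < k then of_bool (i = j) + of_bool (i = k)
     else of_bool (i = k) + \<i> * of_bool (i = j))"
  by (simp add: gell_mann_vec_def)

lemma gell_mann_proj_eq_ket_bra:
  assumes "j < d" and "k < d"
  shows "gell_mann_proj d j k =
    of_real (gell_mann_weight j k) \<cdot>\<^sub>m ket_bra (gell_mann_vec d j k) (gell_mann_vec d j k)"
  using assms
  by (intro eq_matI)
    (auto simp: gell_mann_proj_def gell_mann_def basis_proj_def J_mat_def gell_mann_weight_def
      gell_mann_vec_def algebra_simps)

lemma gell_mann_vec_cscalar_prod:
  assumes "w \<in> carrier_vec d" and "j < d" and "k < d"
  shows "w \<bullet>c gell_mann_vec d j k =
    (if j = k then w $ j else if j < k then w $ j + w $ k else w $ k - \<i> * w $ j)"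
proof -
  have "conjugate (unit_vec d i) = (unit_vec d i :: complex vec)" for i
    by (rule eq_vecI) (auto simp: unit_vec_def)
  then show ?thesis
    using assms
    by (auto simp: gell_mann_vec_def scalar_prod_add_distrib[of _ d] conjugate_add_vec[of _ d]
        conjugate_smult_vec)
qed

lemma mult_mat_gell_mann_vec_index:
  assumes "A \<in> carrier_mat d d" and "j < d" and "k < d" and "i < d"
  shows "(A *\<^sub>v gell_mann_vec d j k) $ i =
    (if j = k then A $$ (i, j)
     else if j < k then A $$ (i, j) + A $$ (i, k)
     else A $$ (i, k) + \<i> * A $$ (i, j))"
  using assms
  by (auto simp: gell_mann_vec_def scalar_prod_add_distrib[of _ d])

text \<open>Multiplying c |v><v| by \<open>A\<close> on the left only replaces the ket v by Av, so
  the trace is c times the inner product of Av with v. Completeness and the overlaps both rest on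
  this formula.\<close>

lemma mat_trace_mult_gell_mann_proj:
  assumes A: "A \<in> carrier_mat d d" and jk: "j < d" "k < d"
  shows "mat_trace (A * gell_mann_proj d j k) =
    (if j = k then A $$ (j, j)
     else if j < k then (A $$ (j, j) + A $$ (k, k) + (A $$ (j, k) + A $$ (k, j))) / 2
     else (A $$ (j, j) + A $$ (k, k) + \<i> * (A $$ (k, j) - A $$ (j, k))) / 2)"
proof -
  let ?v = "gell_mann_vec d j k" and ?c = "complex_of_real (gell_mann_weight j k)"
  have v: "ket_bra ?v ?v \<in> carrier_mat d d" and Av: "A *\<^sub>v ?v \<in> carrier_vec d"
    using A by auto
  have "mat_trace (A * gell_mann_proj d j k) = ?c * ((A *\<^sub>v ?v) \<bullet>c ?v)"
    using A jk v Av
    by (simp add: gell_mann_proj_eq_ket_bra mult_smult_distrib[OF A v] mat_trace_smult[of _ d]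
        mult_ket_bra[of A d] mat_trace_ket_bra)
  also have "\<dots> = (if j = k then A $$ (j, j)
     else if j < k then (A $$ (j, j) + A $$ (k, k) + (A $$ (j, k) + A $$ (k, j))) / 2
     else (A $$ (j, j) + A $$ (k, k) + \<i> * (A $$ (k, j) - A $$ (j, k))) / 2)"
    unfolding gell_mann_vec_cscalar_prod[OF Av jk]
    \<comment> \<open>Without the deletion, entries of \<open>A *\<^sub>v ?v\<close> would unfold to
      row products, hiding them from \<open>mult_mat_gell_mann_vec_index\<close>.\<close>
    using A jk by (simp add: mult_mat_gell_mann_vec_index gell_mann_weight_def algebra_simps
        del: index_mult_mat_vec)
  finally show ?thesis .
qed

lemma informationally_complete_gell_mann_system:
  "informationally_complete d (gell_mann_system d)"
  unfolding informationally_complete_def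
proof (intro ballI impI)
  fix A B :: "complex mat"
  assume A: "A \<in> carrier_mat d d" and B: "B \<in> carrier_mat d d"
    and "\<forall>P \<in> gell_mann_system d. mat_trace (A * P) = mat_trace (B * P)"
  then have eq: "mat_trace (A * gell_mann_proj d j k) = mat_trace (B * gell_mann_proj d j k)"
    if "j < d" "k < d" for j k
    using that by (auto simp: gell_mann_system_def)
  have diag: "A $$ (j, j) = B $$ (j, j)" if "j < d" for j
    using eq[OF that that] A B that by (simp add: mat_trace_mult_gell_mann_proj)
  have off: "A $$ (j, k) = B $$ (j, k) \<and> A $$ (k, j) = B $$ (k, j)" if "j < k" "k < d" for j k
  proof -
    have "A $$ (j, k) + A $$ (k, j) = B $$ (j, k) + B $$ (k, j)"
      using eq[of j k] A B that diag[of j] diag[of k] by (simp add: mat_trace_mult_gell_mann_proj complex_eq_iff)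
    \<comment> \<open>Putting the larger index first selects the case with \<i>. The diagonal terms
      cancel by \<open>diag\<close>, and comparing real and imaginary parts removes the factor
      \<i>.\<close>
    moreover have "A $$ (j, k) - A $$ (k, j) = B $$ (j, k) - B $$ (k, j)"
      using eq[of k j] A B that diag[of j] diag[of k] by (simp add: mat_trace_mult_gell_mann_proj complex_eq_iff)
    ultimately show ?thesis
      by (simp add: complex_eq_iff)
  qed
  show "A = B"
  proof (rule eq_matI)
    fix i j assume "i < dim_row B" "j < dim_col B"
    then show "A $$ (i, j) = B $$ (i, j)"
      using B diag off[of i j] off[of j i] by (cases i j rule: linorder_cases) auto
  qed (use A B in auto)
qed

lemma rank_one_projection_gell_mann_proj:
  assumes "j < d" and "k < d"
  shows "rank_one_projection d (gell_mann_proj d j k)"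
  unfolding gell_mann_proj_eq_ket_bra[OF assms]
  using assms
  by (intro rank_one_projection_ket_bra)
    (auto simp: gell_mann_vec_cscalar_prod gell_mann_vec_index gell_mann_weight_def)

text \<open>The trace formula, with the first projection as \<open>A\<close>, needs only entries
  with indices among \<open>l\<close> and \<open>m\<close>. Two off-diagonal projections sharing
  exactly one index give 1/4; those on the same index pair in opposite order give 1/2, since the
  inner product has squared modulus 2.\<close>

lemma gell_mann_overlap:
  assumes "j < d" and "k < d" and "l < d" and "m < d"
  shows "mat_trace (gell_mann_proj d j k * gell_mann_proj d l m) \<in> {0, 1, 1/2, 1/4}"
proof -
  have P: "gell_mann_proj d j k \<in> carrier_mat d d"
    using rank_one_projection_gell_mann_proj assms by (simp add: rank_one_projection_def)
  have entry: "gell_mann_proj d j k $$ (a, b) = of_real (gell_mann_weight j k) *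
      gell_mann_vec d j k $ a * cnj (gell_mann_vec d j k $ b)" if "j < d" "k < d" "a < d" "b < d" for j k a b
    using that by (simp add: gell_mann_proj_eq_ket_bra)
  show ?thesis
    using assms unfolding mat_trace_mult_gell_mann_proj[OF P assms(3,4)]
    \<comment> \<open>Nine combinations of types; within each, only the coincidences between the two
      index pairs matter.\<close>
    by (cases j k rule: linorder_cases; cases l m rule: linorder_cases)
      (auto simp: entry gell_mann_vec_index gell_mann_weight_def of_bool_def algebra_simps)
qed

theorem theorem3p8p1:
  fixes d :: nat
  assumes "d \<ge> 2"
  shows "(\<forall>P \<in> gell_mann_system d. rank_one_projection d P)
    \<and> informationally_complete d (gell_mann_system d)
    \<and> (\<forall>P \<in> gell_mann_system d. \<forall>P' \<in> gell_mann_system d.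
         mat_trace (P * P') \<in> {0, 1, 1/2, 1/4})"
proof (intro conjI ballI)
  fix P assume "P \<in> gell_mann_system d"
  then show "rank_one_projection d P"
    by (auto simp: gell_mann_system_def rank_one_projection_gell_mann_proj)
next
  show "informationally_complete d (gell_mann_system d)"
    by (rule informationally_complete_gell_mann_system)
next
  fix P P' assume "P \<in> gell_mann_system d" and "P' \<in> gell_mann_system d"
  then obtain j k l m where "j < d" "k < d" "l < d" "m < d"
    and "P = gell_mann_proj d j k" "P' = gell_mann_proj d l m"
    by (auto simp: gell_mann_system_def)
  then show "mat_trace (P * P') \<in> {0, 1, 1/2, 1/4}"
    using gell_mann_overlap by blast
qed

end
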